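(* Fix $0<\beta<1$. Let $M=M(N)$ satisfy $M/N\to 0$ as $N\to\infty$, and let $k=k(N)\le N$ satisfy $k(N)\to\infty$ and $$\frac{k(N)M(N)}{N}\longrightarrow 0 .$$ Let $\mu_N^{(k)}$ be the marginal on $(\sigma_1,\dots,\sigma_k)$ of the Hopfield Gibbs measure $\mu_N$ at inverse temperature $\beta$ with $N$ spins and $M(N)$ patterns, and let $\pi$ be the Rademacher law on $\{-1,+1\}$. Then $$d_{\mathrm{TV}}\big(\mu_N^{(k)},\pi^{\otimes k}\big)\longrightarrow 0\qquad\text{in }\mathbb P_\xi\text{-probability}.$$
   Context: Hopfield model: for each $N$, with $M=M(N)$, let $\xi_i=(\xi_i^1,\dots,\xi_i^M)\in\{-1,+1\}^M$, $i=1,\dots,N$, be i.i.d. random vectors with independent coordinates, $\mathbb E[\xi_i^\nu]=0$ and $\mathbb E[(\xi_i^\nu)^2]=1$; $\mathbb P_\xi$ denotes their law (the disorder). For $\sigma\in\{-1,+1\}^N$ put $m_N(\sigma)=\frac1N\sum_{i=1}^N\sigma_i\xi_i\in\mathbb R^M$. For fixed $\xi$ and $\beta>0$ the Gibbs measure on $\{-1,+1\}^N$ is $\mu_N(\sigma)=\frac1{Z_N}\exp\big(\frac{\beta N}{2}\|m_N(\sigma)\|^2\big)$, where $\|\cdot\|$ is the Euclidean norm and $Z_N$ the normalizing constant; it is a random measure, depending on $\xi$. $\pi(\pm1)=\frac12$. $d_{\mathrm{TV}}(\nu,\varrho)=\sup_A|\nu(A)-\varrho(A)|$. *)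

theory Defs
  imports "HOL-Probability.Probability"
begin

text \<open>
  Vectors indexed by \<open>1,\<dots>,n\<close> are functions on \<open>nat\<close> that take the value \<open>undefined\<close> outside
  \<open>{1..n}\<close>; the same encoding is used for spin configurations and for the vectors \<open>\<xi>\<^sub>i\<close>.
\<close>

definition spin_configs :: "nat \<Rightarrow> (nat \<Rightarrow> real) set" where
  "spin_configs n = {1..n} \<rightarrow>\<^sub>E {-1, 1}"

lemma finite_spin_configs: "finite (spin_configs n)"
  unfolding spin_configs_def by (intro finite_PiE) auto

lemma spin_configs_nonempty: "spin_configs n \<noteq> {}"
  unfolding spin_configs_def by (auto simp: PiE_eq_empty_iff)

text \<open>\<open>\<xi> i \<omega> \<nu>\<close> is the \<open>\<nu>\<close>-th coordinate of the random vector \<open>\<xi>\<^sub>i\<close>.\<close>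

locale hopfield_disorder = prob_space P for P :: "'a measure" +
  fixes N M :: nat and \<xi> :: "nat \<Rightarrow> 'a \<Rightarrow> nat \<Rightarrow> real"
  assumes disorder_values:
      "\<And>i \<omega>. i \<in> {1..N} \<Longrightarrow> \<omega> \<in> space P \<Longrightarrow> \<xi> i \<omega> \<in> spin_configs M"
    and indep_vectors:
      "indep_vars (\<lambda>_. \<Pi>\<^sub>M \<nu>\<in>{1..M}. borel) \<xi> {1..N}"
    and identically_distributed:
      "\<And>i j. i \<in> {1..N} \<Longrightarrow> j \<in> {1..N} \<Longrightarrow>
        distr P (\<Pi>\<^sub>M \<nu>\<in>{1..M}. borel) (\<xi> i) = distr P (\<Pi>\<^sub>M \<nu>\<in>{1..M}. borel) (\<xi> j)"
    and indep_coordinates: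
      "\<And>i. i \<in> {1..N} \<Longrightarrow> indep_vars (\<lambda>_. borel) (\<lambda>\<nu> \<omega>. \<xi> i \<omega> \<nu>) {1..M}"
    and mean_zero:
      "\<And>i \<nu>. i \<in> {1..N} \<Longrightarrow> \<nu> \<in> {1..M} \<Longrightarrow> expectation (\<lambda>\<omega>. \<xi> i \<omega> \<nu>) = 0"
    and second_moment_one:
      "\<And>i \<nu>. i \<in> {1..N} \<Longrightarrow> \<nu> \<in> {1..M} \<Longrightarrow> expectation (\<lambda>\<omega>. (\<xi> i \<omega> \<nu>)\<^sup>2) = 1"

text \<open>In the following definitions \<open>x i \<nu>\<close> is a fixed realisation of the disorder.\<close>

definition overlap :: "nat \<Rightarrow> (nat \<Rightarrow> nat \<Rightarrow> real) \<Rightarrow> (nat \<Rightarrow> real) \<Rightarrow> nat \<Rightarrow> real" where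
  "overlap N x \<sigma> \<nu> = 1 / real N * (\<Sum>i=1..N. \<sigma> i * x i \<nu>)"

definition gibbs_weight ::
    "real \<Rightarrow> nat \<Rightarrow> nat \<Rightarrow> (nat \<Rightarrow> nat \<Rightarrow> real) \<Rightarrow> (nat \<Rightarrow> real) \<Rightarrow> real" where
  "gibbs_weight \<beta> N M x \<sigma> = exp (\<beta> * real N / 2 * (L2_set (overlap N x \<sigma>) {1..M})\<^sup>2)"

definition partition_function :: "real \<Rightarrow> nat \<Rightarrow> nat \<Rightarrow> (nat \<Rightarrow> nat \<Rightarrow> real) \<Rightarrow> real" where
  "partition_function \<beta> N M x = (\<Sum>\<sigma>\<in>spin_configs N. gibbs_weight \<beta> N M x \<sigma>)"

definition gibbs :: "real \<Rightarrow> nat \<Rightarrow> nat \<Rightarrow> (nat \<Rightarrow> nat \<Rightarrow> real) \<Rightarrow> (nat \<Rightarrow> real) pmf" where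
  "gibbs \<beta> N M x = embed_pmf (\<lambda>\<sigma>. if \<sigma> \<in> spin_configs N
     then gibbs_weight \<beta> N M x \<sigma> / partition_function \<beta> N M x else 0)"

lemma partition_function_pos: "partition_function \<beta> N M x > 0"
  unfolding partition_function_def gibbs_weight_def
  by (intro sum_pos finite_spin_configs spin_configs_nonempty) auto

lemma pmf_gibbs:
  "pmf (gibbs \<beta> N M x) \<sigma> = (if \<sigma> \<in> spin_configs N
     then gibbs_weight \<beta> N M x \<sigma> / partition_function \<beta> N M x else 0)"
proof -
  define f where "f = (\<lambda>\<sigma>. if \<sigma> \<in> spin_configs N
     then gibbs_weight \<beta> N M x \<sigma> / partition_function \<beta> N M x else 0)"
  have nonneg: "f \<sigma> \<ge> 0" for \<sigma>
    using partition_function_pos[of \<beta> N M x] by (auto simp: f_def gibbs_weight_def)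
  have "(\<integral>\<^sup>+\<sigma>. ennreal (f \<sigma>) \<partial>count_space UNIV)
      = (\<integral>\<^sup>+\<sigma>. ennreal (f \<sigma>) \<partial>count_space (spin_configs N))"
    by (intro nn_integral_count_space_eq) (auto simp: f_def)
  also have "\<dots> = (\<Sum>\<sigma>\<in>spin_configs N. ennreal (f \<sigma>))"
    by (rule nn_integral_count_space_finite[OF finite_spin_configs])
  also have "\<dots> = ennreal (\<Sum>\<sigma>\<in>spin_configs N. f \<sigma>)"
    by (rule sum_ennreal) (rule nonneg)
  also have "(\<Sum>\<sigma>\<in>spin_configs N. f \<sigma>) = 1"
    using partition_function_pos[of \<beta> N M x]
    by (simp add: f_def sum_divide_distrib[symmetric] partition_function_def)
  finally have "(\<integral>\<^sup>+\<sigma>. ennreal (f \<sigma>) \<partial>count_space UNIV) = 1" by simp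
  then have "pmf (embed_pmf f) \<sigma> = f \<sigma>"
    by (intro pmf_embed_pmf nonneg)
  then show ?thesis by (simp add: gibbs_def f_def)
qed

definition gibbs_marginal ::
    "real \<Rightarrow> nat \<Rightarrow> nat \<Rightarrow> nat \<Rightarrow> (nat \<Rightarrow> nat \<Rightarrow> real) \<Rightarrow> (nat \<Rightarrow> real) pmf" where
  "gibbs_marginal \<beta> N M k x = map_pmf (\<lambda>\<sigma>. restrict \<sigma> {1..k}) (gibbs \<beta> N M x)"

definition rademacher :: "real pmf" where
  "rademacher = pmf_of_set {-1, 1}"

definition rademacher_power :: "nat \<Rightarrow> (nat \<Rightarrow> real) pmf" where
  "rademacher_power k = Pi_pmf {1..k} undefined (\<lambda>_. rademacher)"

definition tv_dist :: "'b pmf \<Rightarrow> 'b pmf \<Rightarrow> real" where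
  "tv_dist p q = (SUP A. \<bar>measure_pmf.prob p A - measure_pmf.prob q A\<bar>)"

text \<open>The supremum is taken in the reals, so it is only meaningful for a bounded set.\<close>

lemma tv_dist_bdd:
  "bdd_above (range (\<lambda>A. \<bar>measure_pmf.prob p A - measure_pmf.prob q A\<bar>))"
proof (rule bdd_aboveI2[where M = 1])
  fix A
  show "\<bar>measure_pmf.prob p A - measure_pmf.prob q A\<bar> \<le> 1"
    using measure_pmf.prob_le_1[of p A] measure_pmf.prob_le_1[of q A]
      measure_nonneg[of "measure_pmf p" A] measure_nonneg[of "measure_pmf q" A] by linarith
qed

text \<open>
  Convergence in probability to a constant, where the \<open>n\<close>-th random variable may live on
  its own probability space \<open>P n\<close>.
\<close>

definition tendsto_in_prob ::
    "(nat \<Rightarrow> 'a measure) \<Rightarrow> (nat \<Rightarrow> 'a \<Rightarrow> real) \<Rightarrow> real \<Rightarrow> bool" where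
  "tendsto_in_prob P X c \<longleftrightarrow>
     (\<forall>\<epsilon>>0. (\<lambda>n. measure (P n) {\<omega> \<in> space (P n). \<bar>X n \<omega> - c\<bar> > \<epsilon>}) \<longlonglongrightarrow> 0)"

end

theory Submission
  imports Defs
begin

text \<open>
  Relative entropy with respect to a product measure is superadditive over disjoint blocks of
  coordinates. Among the \<open>\<lfloor>N/k\<rfloor>\<close> disjoint blocks of \<open>k\<close> spins all block marginals have the same
  disorder-averaged distance to uniformity, so by Pinsker's inequality the squared distance of one
  block is of the order \<open>k/N\<close> times the entropy of the whole Gibbs measure. That entropy is at most a
  constant times \<open>ln (Z\<^sub>N(\<beta>') / 2\<^sup>N)\<close> for any \<open>\<beta> < \<beta>' < 1\<close>, and by Jensen's inequality and a Gaussian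
  linearisation of the square its mean is at most \<open>M ln (1 / sqrt (1 - \<beta>'))\<close>. Hence the mean distance
  tends to \<open>0\<close> when \<open>kM/N\<close> does. Superadditivity and Pinsker's inequality are used together
  in dual form: the Donsker--Varadhan inequality is applied to a sum of test functions, one per block.
\<close>

subsection \<open>Averages and relative entropy on finite sets\<close>

text \<open>Expectation under the uniform law. All estimates are made with finite averages;
  \<open>prob_patterns\<close> links them to the probability space of the disorder.\<close>

definition avg :: "'b set \<Rightarrow> ('b \<Rightarrow> real) \<Rightarrow> real" where
  "avg A f = (\<Sum>a\<in>A. f a) / real (card A)"

lemma avg_const: "finite A \<Longrightarrow> A \<noteq> {} \<Longrightarrow> avg A (\<lambda>_. c) = c"
  by (simp add: avg_def)

lemma avg_add: "avg A (\<lambda>a. f a + g a) = avg A f + avg A g"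
  by (simp add: avg_def sum.distrib add_divide_distrib)

lemma avg_cmult: "avg A (\<lambda>a. c * f a) = c * avg A f"
  by (simp add: avg_def sum_distrib_left)

lemma avg_sum: "avg A (\<lambda>a. \<Sum>j\<in>J. f j a) = (\<Sum>j\<in>J. avg A (f j))"
  unfolding avg_def by (subst sum.swap) (simp add: sum_divide_distrib)

lemma avg_mono: "(\<And>a. a \<in> A \<Longrightarrow> f a \<le> g a) \<Longrightarrow> avg A f \<le> avg A g"
  by (simp add: avg_def divide_right_mono sum_mono)

lemma avg_nonneg: "(\<And>a. a \<in> A \<Longrightarrow> 0 \<le> f a) \<Longrightarrow> 0 \<le> avg A f"
  by (simp add: avg_def sum_nonneg)

lemma avg_pos: "finite A \<Longrightarrow> A \<noteq> {} \<Longrightarrow> (\<And>a. a \<in> A \<Longrightarrow> 0 < f a) \<Longrightarrow> 0 < avg A f"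
  unfolding avg_def by (intro divide_pos_pos sum_pos) (auto simp: card_gt_0_iff)

lemma avg_ge_one:
  assumes "finite A" "A \<noteq> {}" "\<And>a. a \<in> A \<Longrightarrow> 1 \<le> f a"
  shows "1 \<le> avg A f"
  using avg_mono[of A "\<lambda>_. 1" f] assms by (simp add: avg_const)

lemma avg_swap: "avg A (\<lambda>a. avg B (f a)) = avg B (\<lambda>b. avg A (\<lambda>a. f a b))"
  unfolding avg_def sum_divide_distrib by (subst sum.swap) (simp add: field_simps)

lemma avg_reindex_involution:
  assumes "\<And>a. a \<in> A \<Longrightarrow> h a \<in> A" "\<And>a. a \<in> A \<Longrightarrow> h (h a) = a"
  shows "avg A (\<lambda>a. f (h a)) = avg A f"
  unfolding avg_def
  by (intro arg_cong2[where f = "(/)"] refl sum.reindex_bij_witness[where i = h and j = h])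
    (use assms in auto)

text \<open>Jensen's inequality for the logarithm: the tangent to \<open>ln\<close> at
  \<open>c\<close> lies above its graph.\<close>

lemma avg_ln_le:
  assumes "finite A" "A \<noteq> {}" "\<And>a. a \<in> A \<Longrightarrow> 0 < f a" "avg A f \<le> c"
  shows "avg A (\<lambda>a. ln (f a)) \<le> ln c"
proof -
  have "0 < c" using avg_pos[of A f] assms by force
  have "avg A (\<lambda>a. ln (f a)) \<le> avg A (\<lambda>a. (ln c - 1) + (1 / c) * f a)"
  proof (rule avg_mono)
    fix a assume "a \<in> A"
    then have "ln (f a / c) \<le> f a / c - 1"
      using assms(3) \<open>0 < c\<close> by (intro ln_le_minus_one) auto
    then show "ln (f a) \<le> (ln c - 1) + (1 / c) * f a"
      using assms(3)[OF \<open>a \<in> A\<close>] \<open>0 < c\<close> by (simp add: ln_div)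
  qed
  also have "\<dots> = (ln c - 1) + avg A f / c"
    unfolding avg_add avg_cmult avg_const[OF assms(1,2)] by simp
  also have "\<dots> \<le> ln c"
    using assms(4) \<open>0 < c\<close> by simp
  finally show ?thesis .
qed

text \<open>Donsker--Varadhan inequality with uniform reference law: the first sum on the right is
  the relative entropy of \<open>p\<close>. The gap between the two sides is the entropy of
  \<open>p\<close> relative to the law tilted by \<open>exp \<psi>\<close>, hence
  nonnegative.\<close>

lemma sum_le_entropy_plus_ln_avg_exp:
  assumes A: "finite A" "A \<noteq> {}"
    and p: "\<And>a. a \<in> A \<Longrightarrow> 0 < p a" "(\<Sum>a\<in>A. p a) = 1"
  shows "(\<Sum>a\<in>A. p a * \<psi> a)
    \<le> (\<Sum>a\<in>A. p a * ln (real (card A) * p a)) + ln (avg A (\<lambda>a. exp (\<psi> a)))"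
proof -
  define Z where "Z = avg A (\<lambda>a. exp (\<psi> a))"
  have Z: "0 < Z" unfolding Z_def by (intro avg_pos A) auto
  have c: "0 < real (card A)" using A by (simp add: card_gt_0_iff)
  have "(\<Sum>a\<in>A. p a * (\<psi> a - ln (real (card A) * p a) - ln Z))
      \<le> (\<Sum>a\<in>A. exp (\<psi> a) / (real (card A) * Z) - p a)"
  proof (rule sum_mono)
    fix a assume a: "a \<in> A"
    \<comment> \<open>\<open>exp t\<close> is the density of the tilted law with respect to
      \<open>p\<close>; the elementary \<open>1 + t \<le> exp t\<close> is used pointwise.\<close>
    define t where "t = \<psi> a - ln (real (card A) * p a) - ln Z"
    have "exp t = exp (\<psi> a) / (real (card A) * p a * Z)"
      using p(1)[OF a] Z c by (simp add: t_def exp_diff)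
    moreover have "p a * t \<le> p a * (exp t - 1)"
      using p(1)[OF a] exp_ge_add_one_self[of t] by (intro mult_left_mono) linarith+
    ultimately show "p a * (\<psi> a - ln (real (card A) * p a) - ln Z)
        \<le> exp (\<psi> a) / (real (card A) * Z) - p a"
      using p(1)[OF a] by (simp add: t_def right_diff_distrib)
  qed
  also have "\<dots> = (\<Sum>a\<in>A. exp (\<psi> a)) / (real (card A) * Z) - 1"
    using p(2) by (simp add: sum_subtractf sum_divide_distrib)
  also have "\<dots> = 0"
    using Z c by (auto simp: Z_def avg_def)
  finally have "(\<Sum>a\<in>A. p a * \<psi> a - p a * ln (real (card A) * p a) - p a * ln Z) \<le> 0"
    by (simp add: algebra_simps)
  then show ?thesis
    using p(2) by (simp add: sum_subtractf sum_distrib_right[symmetric] Z_def)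
qed

text \<open>
  Applying the entropy inequality to \<open>\<beta>' U\<close> itself bounds the relative entropy of the Gibbs
  measure, since that entropy is the mean of \<open>\<beta> U\<close> minus a nonnegative constant.
\<close>

lemma gibbs_sum_le:
  fixes U :: "'b \<Rightarrow> real"
  assumes A: "finite A" "A \<noteq> {}" and U: "\<And>a. a \<in> A \<Longrightarrow> 0 \<le> U a"
    and \<beta>: "0 < \<beta>" "\<beta> < \<beta>'"
    and p: "\<And>a. a \<in> A \<Longrightarrow> p a = exp (\<beta> * U a) / (\<Sum>b\<in>A. exp (\<beta> * U b))"
  shows "(\<Sum>a\<in>A. p a * \<psi> a)
    \<le> \<beta> / (\<beta>' - \<beta>) * ln (avg A (\<lambda>a. exp (\<beta>' * U a))) + ln (avg A (\<lambda>a. exp (\<psi> a)))"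
proof -
  define Z where "Z = (\<Sum>b\<in>A. exp (\<beta> * U b))"
  define F where "F = ln (avg A (\<lambda>a. exp (\<beta> * U a)))"
  define F' where "F' = ln (avg A (\<lambda>a. exp (\<beta>' * U a)))"
  define H where "H = (\<Sum>a\<in>A. p a * ln (real (card A) * p a))"
  define u where "u = (\<Sum>a\<in>A. p a * U a)"
  have c: "0 < real (card A)" using A by (simp add: card_gt_0_iff)
  have Z: "0 < Z" unfolding Z_def by (intro sum_pos A) auto
  have pos: "0 < p a" if "a \<in> A" for a
    using p[OF that] Z by (simp add: Z_def)
  have sum1: "(\<Sum>a\<in>A. p a) = 1"
  proof -
    have "(\<Sum>a\<in>A. p a) = Z / Z"
      using p unfolding Z_def by (subst sum_divide_distrib) (intro sum.cong refl)
    then show ?thesis using Z by simp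
  qed
  have F0: "0 \<le> F"
    unfolding F_def using A U \<beta> by (intro ln_ge_zero avg_ge_one) auto
  have "H = (\<Sum>a\<in>A. \<beta> * (p a * U a) - F * p a)"
    unfolding H_def
  proof (rule sum.cong)
    fix a assume a: "a \<in> A"
    have "real (card A) * p a = exp (\<beta> * U a) / (Z / real (card A))"
      using p[OF a] by (simp add: Z_def)
    then have "ln (real (card A) * p a) = \<beta> * U a - F"
      using Z c by (simp add: ln_div ln_mult F_def avg_def Z_def del: divide_divide_eq_right)
    then show "p a * ln (real (card A) * p a) = \<beta> * (p a * U a) - F * p a"
      by (simp add: right_diff_distrib)
  qed simp
  then have H: "H = \<beta> * u - F"
    by (simp add: sum_subtractf sum_distrib_left[symmetric] sum1 u_def)
  \<comment> \<open>The term \<open>\<beta> * u\<close> inside \<open>H\<close> is absorbed on the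
    left; this is why the logarithm is taken at a larger inverse temperature.\<close>
  have "\<beta>' * u \<le> H + F'"
    using sum_le_entropy_plus_ln_avg_exp[OF A pos sum1, of "\<lambda>a. \<beta>' * U a"]
    by (simp add: H_def F'_def u_def sum_distrib_left mult.left_commute)
  then have "(\<beta>' - \<beta>) * u \<le> F'"
    using H F0 by (simp add: algebra_simps)
  then have "u \<le> F' / (\<beta>' - \<beta>)"
    using \<beta> by (simp add: pos_le_divide_eq mult.commute)
  then have "\<beta> * u \<le> \<beta> / (\<beta>' - \<beta>) * F'"
    using \<beta> by (metis mult_left_mono less_imp_le times_divide_eq_left times_divide_eq_right)
  then have "H \<le> \<beta> / (\<beta>' - \<beta>) * F'"
    using H F0 by linarith
  then show ?thesis
    using sum_le_entropy_plus_ln_avg_exp[OF A pos sum1, of \<psi>]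
    unfolding H_def F'_def by linarith
qed

subsection \<open>Independence of disjoint coordinates\<close>

text \<open>The finite substitute for measurability with respect to the coordinates in
  \<open>S\<close>; disjoint sets of coordinates will give independence under the uniform
  law.\<close>

definition depends_on :: "(('i \<Rightarrow> 'v) \<Rightarrow> real) \<Rightarrow> 'i set \<Rightarrow> bool" where
  "depends_on f S \<longleftrightarrow> (\<forall>\<sigma> \<sigma>'. (\<forall>i\<in>S. \<sigma> i = \<sigma>' i) \<longrightarrow> f \<sigma> = f \<sigma>')"

lemma depends_onD: "depends_on f S \<Longrightarrow> (\<And>i. i \<in> S \<Longrightarrow> \<sigma> i = \<sigma>' i) \<Longrightarrow> f \<sigma> = f \<sigma>'"
  by (auto simp: depends_on_def)

text \<open>
  Exchanging the coordinates in \<open>T\<close> between two independent copies \<open>\<sigma>\<close>, \<open>\<sigma>'\<close> is an involution that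
  turns \<open>f \<sigma> * g \<sigma>'\<close> into \<open>f \<sigma> * g \<sigma>\<close>.
\<close>

lemma avg_mult_depends_on:
  assumes "finite I" "finite V" "V \<noteq> {}" "S \<inter> T = {}"
    and f: "depends_on f S" and g: "depends_on g T"
  shows "avg (I \<rightarrow>\<^sub>E V) (\<lambda>\<sigma>. f \<sigma> * g \<sigma>) = avg (I \<rightarrow>\<^sub>E V) f * avg (I \<rightarrow>\<^sub>E V) g"
proof -
  let ?A = "I \<rightarrow>\<^sub>E V"
  have c: "real (card ?A) \<noteq> 0"
    using assms(1-3) by (simp add: card_funcsetE card_gt_0_iff)
  define h where "h = (\<lambda>(\<sigma>, \<sigma>'). (override_on \<sigma> \<sigma>' T, override_on \<sigma>' \<sigma> T) :: ('a \<Rightarrow> 'b) \<times> ('a \<Rightarrow> 'b))"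
  have hh: "h (h z) = z" for z
    by (auto simp: h_def override_on_def fun_eq_iff split: prod.splits)
  have hA: "h z \<in> ?A \<times> ?A" if "z \<in> ?A \<times> ?A" for z
    using that by (auto simp: h_def override_on_def PiE_def extensional_def split: prod.splits)
  have "(\<Sum>\<sigma>\<in>?A. f \<sigma>) * (\<Sum>\<sigma>\<in>?A. g \<sigma>) = (\<Sum>(\<sigma>, \<sigma>')\<in>?A \<times> ?A. f \<sigma> * g \<sigma>')"
    by (simp add: sum_product sum.cartesian_product)
  also have "\<dots> = (\<Sum>(\<sigma>, \<sigma>')\<in>?A \<times> ?A. f \<sigma> * g \<sigma>)"
  proof (rule sum.reindex_bij_witness[where i = h and j = h])
    fix z assume "z \<in> ?A \<times> ?A"
    obtain \<sigma> \<sigma>' where z: "z = (\<sigma>, \<sigma>')" by force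
    have "f (override_on \<sigma> \<sigma>' T) = f \<sigma>"
      by (rule depends_onD[OF f]) (use assms(4) in \<open>auto simp: override_on_def\<close>)
    moreover have "g (override_on \<sigma> \<sigma>' T) = g \<sigma>'"
      by (rule depends_onD[OF g]) (auto simp: override_on_def)
    ultimately show "(case h z of (\<sigma>, \<sigma>') \<Rightarrow> f \<sigma> * g \<sigma>) = (case z of (\<sigma>, \<sigma>') \<Rightarrow> f \<sigma> * g \<sigma>')"
      by (simp add: z h_def)
  qed (use hh hA in auto)
  also have "\<dots> = real (card ?A) * (\<Sum>\<sigma>\<in>?A. f \<sigma> * g \<sigma>)"
    by (simp add: sum.cartesian_product[symmetric] sum_distrib_left)
  finally show ?thesis
    using c by (simp add: avg_def field_simps)
qed

lemma avg_prod_depends_on: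
  assumes I: "finite I" and V: "finite V" "V \<noteq> {}" and "finite J"
    and "\<And>j j'. j \<in> J \<Longrightarrow> j' \<in> J \<Longrightarrow> j \<noteq> j' \<Longrightarrow> S j \<inter> S j' = {}"
    and "\<And>j. j \<in> J \<Longrightarrow> depends_on (f j) (S j)"
  shows "avg (I \<rightarrow>\<^sub>E V) (\<lambda>\<sigma>. \<Prod>j\<in>J. f j \<sigma>) = (\<Prod>j\<in>J. avg (I \<rightarrow>\<^sub>E V) (f j))"
  using assms(4-)
proof (induction J)
  case empty
  show ?case
    using I V by (simp add: avg_const finite_PiE PiE_eq_empty_iff)
next
  case (insert j J)
  have "depends_on (\<lambda>\<sigma>. \<Prod>j\<in>J. f j \<sigma>) (\<Union>j\<in>J. S j)"
    unfolding depends_on_def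
    by (intro allI impI prod.cong refl depends_onD[OF insert.prems(2)]) auto
  moreover have "S j \<inter> (\<Union>j\<in>J. S j) = {}"
    using insert.prems(1)[of j] insert.hyps by auto
  ultimately have "avg (I \<rightarrow>\<^sub>E V) (\<lambda>\<sigma>. f j \<sigma> * (\<Prod>j\<in>J. f j \<sigma>))
      = avg (I \<rightarrow>\<^sub>E V) (f j) * avg (I \<rightarrow>\<^sub>E V) (\<lambda>\<sigma>. \<Prod>j\<in>J. f j \<sigma>)"
    using insert.prems(2)[of j] I V by (intro avg_mult_depends_on) auto
  then show ?case
    using insert by simp
qed

section \<open>Exponential moments of bounded centred functions\<close>

lemma exp_le_one_plus_plus_square:
  fixes x :: real
  assumes "\<bar>x\<bar> \<le> 1"
  shows "exp x \<le> 1 + x + x\<^sup>2"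
proof (cases "0 \<le> x")
  case True
  then show ?thesis using exp_bound assms by auto
next
  case False
  \<comment> \<open>The product \<open>(1 + x + x\<^sup>2) * (1 - x)\<close> equals
    \<open>1 - x ^ 3\<close>, and \<open>1 - x \<le> exp (- x)\<close>.\<close>
  have "x ^ 3 \<le> 0" using False by (simp add: power_le_zero_eq)
  then have "1 \<le> (1 + x + x\<^sup>2) * (1 - x)"
    by (simp add: algebra_simps power2_eq_square power3_eq_cube)
  also have "\<dots> \<le> (1 + x + x\<^sup>2) * exp (- x)"
    using exp_ge_add_one_self[of "- x"] assms by (intro mult_left_mono) auto
  finally show ?thesis
    by (simp add: exp_minus field_simps)
qed

text \<open>The linear term averages to 0, so only the quadratic one is left;
  \<open>c \<le> 1\<close> keeps \<open>c * f a\<close> in the range where the quadratic bound for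
  \<open>exp\<close> holds.\<close>

lemma avg_exp_le:
  assumes "finite A" "A \<noteq> {}" "\<And>a. a \<in> A \<Longrightarrow> \<bar>f a\<bar> \<le> 1" "avg A f = 0" "0 \<le> c" "c \<le> 1"
  shows "avg A (\<lambda>a. exp (c * f a)) \<le> exp (c\<^sup>2)"
proof -
  have "avg A (\<lambda>a. exp (c * f a)) \<le> avg A (\<lambda>a. (1 + c\<^sup>2) + c * f a)"
  proof (rule avg_mono)
    fix a assume a: "a \<in> A"
    have "exp (c * f a) \<le> 1 + c * f a + (c * f a)\<^sup>2"
      using assms(3)[OF a] assms(5,6)
      by (intro exp_le_one_plus_plus_square) (simp add: abs_mult mult_le_one)
    moreover have "(c * f a)\<^sup>2 \<le> c\<^sup>2"
      using assms(3)[OF a] by (simp add: power_mult_distrib abs_square_le_1 mult_left_le)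
    ultimately show "exp (c * f a) \<le> (1 + c\<^sup>2) + c * f a" by simp
  qed
  also have "\<dots> = 1 + c\<^sup>2"
    using assms by (simp add: avg_add avg_cmult avg_const)
  also have "\<dots> \<le> exp (c\<^sup>2)" by simp
  finally show ?thesis .
qed

subsection \<open>The annealed partition function\<close>

lemma cosh_le_exp_half_square:
  fixes t :: real
  shows "cosh t \<le> exp (t\<^sup>2 / 2)"
proof -
  have pos: "cosh t \<le> exp (t\<^sup>2 / 2)" if "0 \<le> t" for t :: real
  proof -
    \<comment> \<open>Hoeffding's bound for a fair variable with values \<open>- t\<close> and
      \<open>t\<close>: mass \<open>1/2\<close> at each end of an interval of length
      \<open>2 * t\<close>.\<close>
    have "- (2 * t) * (1/2) + ln (1 + (1/2) * (exp (2 * t) - 1)) \<le> (2 * t)\<^sup>2 / 8"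
      using that by (intro Hoeffdings_lemma_aux) auto
    also have "1 + (1/2) * (exp (2 * t) - 1) = exp t * cosh t"
      by (simp add: cosh_def field_simps flip: exp_add)
    also have "ln (exp t * cosh t) = t + ln (cosh t)"
      by (simp add: ln_mult cosh_real_pos)
    finally have "ln (cosh t) \<le> t\<^sup>2 / 2" by (simp add: power2_eq_square)
    then show ?thesis
      by (metis cosh_real_pos exp_le_cancel_iff exp_ln)
  qed
  show ?thesis
    using pos[of t] pos[of "- t"] by (cases "0 \<le> t") auto
qed

text \<open>Completing the square gives a multiple of the normal density with mean
  \<open>a\<close>.\<close>

lemma has_bochner_integral_std_normal_exp:
  "has_bochner_integral lborel (\<lambda>g. std_normal_density g * exp (a * g)) (exp (a\<^sup>2 / 2))"
proof -
  have "std_normal_density g * exp (a * g) = exp (a\<^sup>2 / 2) * normal_density a 1 g" for g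
    by (simp add: normal_density_def exp_add[symmetric] field_simps power2_eq_square)
  moreover have "has_bochner_integral lborel (\<lambda>g. exp (a\<^sup>2 / 2) * normal_density a 1 g) (exp (a\<^sup>2 / 2) * 1)"
    by (intro has_bochner_integral_mult_right)
      (simp add: has_bochner_integral_iff)
  ultimately show ?thesis by simp
qed

text \<open>The integrand is proportional to the centred normal density of variance
  \<open>1 / (1 - \<beta>)\<close>; this is where the threshold 1 for the inverse temperature comes
  from.\<close>

lemma has_bochner_integral_std_normal_exp_square:
  assumes "\<beta> < 1"
  shows "has_bochner_integral lborel (\<lambda>g. std_normal_density g * exp (\<beta> * g\<^sup>2 / 2)) (1 / sqrt (1 - \<beta>))"
proof -
  have s: "0 < sqrt (1 - \<beta>)" "(sqrt (1 - \<beta>))\<^sup>2 = 1 - \<beta>" using assms by auto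
  have "std_normal_density g * exp (\<beta> * g\<^sup>2 / 2)
      = 1 / sqrt (1 - \<beta>) * normal_density 0 (1 / sqrt (1 - \<beta>)) g" for g
  proof -
    have "exp (- g\<^sup>2 / 2) * exp (\<beta> * g\<^sup>2 / 2) = exp (- g\<^sup>2 / (2 * (1 / sqrt (1 - \<beta>))\<^sup>2))"
      using s by (simp add: exp_add[symmetric] power_divide field_simps)
    moreover have "1 / sqrt (2 * pi) = 1 / sqrt (1 - \<beta>) * (1 / sqrt (2 * pi * (1 / sqrt (1 - \<beta>))\<^sup>2))"
      using s assms by (simp add: power_divide real_sqrt_divide real_sqrt_mult)
    ultimately show ?thesis
      by (simp add: normal_density_def mult.assoc)
  qed
  moreover have "has_bochner_integral lborel
      (\<lambda>g. 1 / sqrt (1 - \<beta>) * normal_density 0 (1 / sqrt (1 - \<beta>)) g) (1 / sqrt (1 - \<beta>) * 1)"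
    using s by (intro has_bochner_integral_mult_right) (simp add: has_bochner_integral_iff)
  ultimately show ?thesis by simp
qed

lemma card_spin_configs: "card (spin_configs n) = 2 ^ n"
  by (simp add: spin_configs_def card_funcsetE numeral_2_eq_2)

lemma spin_configs_values: "\<sigma> \<in> spin_configs n \<Longrightarrow> i \<in> {1..n} \<Longrightarrow> \<sigma> i = -1 \<or> \<sigma> i = 1"
  unfolding spin_configs_def by (drule (1) PiE_mem) simp

text \<open>Under uniform \<open>c\<close> the products \<open>\<sigma> i * c i\<close> are
  independent fair signs, each with moment generating function \<open>cosh a\<close>.\<close>

lemma avg_spin_configs_exp_linear:
  assumes "\<sigma> \<in> spin_configs N"
  shows "avg (spin_configs N) (\<lambda>c. exp (a * (\<Sum>i=1..N. \<sigma> i * c i))) = cosh a ^ N"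
proof -
  have "(\<Sum>c\<in>spin_configs N. exp (a * (\<Sum>i=1..N. \<sigma> i * c i)))
      = (\<Sum>c\<in>{1..N} \<rightarrow>\<^sub>E {-1, 1}. \<Prod>i=1..N. exp (a * (\<sigma> i * c i)))"
    by (simp add: spin_configs_def exp_sum sum_distrib_left)
  also have "\<dots> = (\<Prod>i=1..N. \<Sum>s\<in>{-1, 1}. exp (a * (\<sigma> i * s)))"
    by (rule prod_sum_PiE[symmetric]) auto
  also have "\<dots> = (\<Prod>i=1..N. 2 * cosh a)"
  proof (rule prod.cong)
    fix i assume "i \<in> {1..N}"
    then show "(\<Sum>s\<in>{-1, 1}. exp (a * (\<sigma> i * s))) = 2 * cosh a"
      using spin_configs_values[OF assms, of i] by (auto simp: cosh_def)
  qed simp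
  also have "\<dots> = 2 ^ N * cosh a ^ N"
    by (simp only: prod_constant power_mult_distrib card_atLeastAtMost diff_Suc_1)
  finally have "avg (spin_configs N) (\<lambda>c. exp (a * (\<Sum>i=1..N. \<sigma> i * c i)))
      = 2 ^ N * cosh a ^ N / 2 ^ N"
    by (simp only: avg_def card_spin_configs of_nat_power of_nat_numeral)
  also have "\<dots> = cosh a ^ N" by simp
  finally show ?thesis .
qed

text \<open>The square in the exponent is linearised by a Gaussian integral.\<close>

lemma avg_spin_configs_exp_square:
  assumes \<beta>: "0 \<le> \<beta>" "\<beta> < 1" and "0 < N" and \<sigma>: "\<sigma> \<in> spin_configs N"
  shows "avg (spin_configs N) (\<lambda>c. exp (\<beta> / (2 * real N) * (\<Sum>i=1..N. \<sigma> i * c i)\<^sup>2))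
    \<le> 1 / sqrt (1 - \<beta>)"
proof -
  \<comment> \<open>Chosen so that \<open>(b * S c)\<^sup>2 / 2\<close> is the given exponent, which
    the Gaussian moment generating function at \<open>b * S c\<close> reproduces.\<close>
  define b where "b = sqrt (\<beta> / real N)"
  define S where "S = (\<lambda>c. \<Sum>i=1..N. \<sigma> i * c i)"
  have b: "b\<^sup>2 = \<beta> / real N" using \<beta> by (simp add: b_def)
  have "has_bochner_integral lborel
      (\<lambda>g. (\<Sum>c\<in>spin_configs N. std_normal_density g * exp ((b * S c) * g)) * (1 / real (card (spin_configs N))))
      ((\<Sum>c\<in>spin_configs N. exp ((b * S c)\<^sup>2 / 2)) * (1 / real (card (spin_configs N))))"
    by (intro has_bochner_integral_mult_left has_bochner_integral_sum has_bochner_integral_std_normal_exp)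
  moreover have "(\<Sum>c\<in>spin_configs N. std_normal_density g * exp ((b * S c) * g)) * (1 / real (card (spin_configs N)))
      = std_normal_density g * cosh (b * g) ^ N" for g
    using avg_spin_configs_exp_linear[OF \<sigma>, of "b * g"]
    by (simp add: avg_def S_def sum_distrib_left[symmetric] mult_ac)
  moreover have "(b * S c)\<^sup>2 / 2 = \<beta> / (2 * real N) * (S c)\<^sup>2" for c
    by (simp add: power_mult_distrib b)
  ultimately have 1: "has_bochner_integral lborel (\<lambda>g. std_normal_density g * cosh (b * g) ^ N)
      (avg (spin_configs N) (\<lambda>c. exp (\<beta> / (2 * real N) * (S c)\<^sup>2)))"
    by (simp add: avg_def)
  \<comment> \<open>Comparison of signs with Gaussians: since
    \<open>N * b\<^sup>2 = \<beta>\<close>, the majorant no longer depends on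
    \<open>N\<close>.\<close>
  have 2: "std_normal_density g * cosh (b * g) ^ N \<le> std_normal_density g * exp (\<beta> * g\<^sup>2 / 2)" for g
  proof (intro mult_left_mono)
    have "cosh (b * g) ^ N \<le> exp ((b * g)\<^sup>2 / 2) ^ N"
      by (intro power_mono cosh_le_exp_half_square) (simp add: cosh_real_nonneg)
    also have "\<dots> = exp (\<beta> * g\<^sup>2 / 2)"
      using \<open>0 < N\<close> by (simp add: exp_of_nat_mult[symmetric] power_mult_distrib b)
    finally show "cosh (b * g) ^ N \<le> exp (\<beta> * g\<^sup>2 / 2)" .
  qed simp
  note 3 = has_bochner_integral_std_normal_exp_square[OF \<beta>(2)]
  have "(\<integral>g. std_normal_density g * cosh (b * g) ^ N \<partial>lborel)
      \<le> (\<integral>g. std_normal_density g * exp (\<beta> * g\<^sup>2 / 2) \<partial>lborel)"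
    using 1 3 by (intro integral_mono) (simp_all only: has_bochner_integral_iff 2)
  then show ?thesis
    unfolding has_bochner_integral_integral_eq[OF 1] has_bochner_integral_integral_eq[OF 3] S_def .
qed

section \<open>Sign matrices and the independence of their columns\<close>

abbreviation patterns :: "nat \<Rightarrow> nat \<Rightarrow> (nat \<Rightarrow> nat \<Rightarrow> real) set" where
  "patterns N M \<equiv> {1..N} \<rightarrow>\<^sub>E spin_configs M"

lemma finite_patterns: "finite (patterns N M)"
  by (intro finite_PiE finite_spin_configs) auto

lemma patterns_nonempty: "patterns N M \<noteq> {}"
  by (simp add: PiE_eq_empty_iff spin_configs_nonempty)

lemma card_patterns: "card (patterns N M) = (2 ^ M) ^ N"
  by (simp add: card_funcsetE card_spin_configs)

lemma patterns_iff:
  "x \<in> patterns N M \<longleftrightarrow>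
    (\<forall>i\<in>{1..N}. (\<forall>\<nu>\<in>{1..M}. x i \<nu> \<in> {-1, 1}) \<and> (\<forall>\<nu>. \<nu> \<notin> {1..M} \<longrightarrow> x i \<nu> = undefined)) \<and>
    (\<forall>i. i \<notin> {1..N} \<longrightarrow> x i = undefined)"
  unfolding spin_configs_def PiE_iff extensional_def mem_Collect_eq by (rule refl)

text \<open>\<open>patterns\<close> lists a matrix by its \<open>N\<close> rows, while the energy is
  a sum over its \<open>M\<close> columns. The double restriction puts \<open>undefined\<close> back
  outside both index ranges, which makes transposition a bijection.\<close>

definition transpose_pattern :: "nat \<Rightarrow> nat \<Rightarrow> (nat \<Rightarrow> nat \<Rightarrow> real) \<Rightarrow> nat \<Rightarrow> nat \<Rightarrow> real" where
  "transpose_pattern N M y = (\<lambda>i\<in>{1..N}. \<lambda>\<nu>\<in>{1..M}. y \<nu> i)"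

lemma transpose_pattern_mem: "y \<in> patterns M N \<Longrightarrow> transpose_pattern N M y \<in> patterns N M"
  unfolding patterns_iff transpose_pattern_def by (simp add: restrict_def)

lemma transpose_pattern_twice:
  "y \<in> patterns M N \<Longrightarrow> transpose_pattern M N (transpose_pattern N M y) = y"
  unfolding patterns_iff transpose_pattern_def by (simp add: restrict_def fun_eq_iff)

text \<open>Independence of the columns of a uniform sign matrix: after transposition this is the
  distributive law for a product of sums over rows.\<close>

lemma sum_patterns_prod_columns:
  fixes \<phi> :: "(nat \<Rightarrow> real) \<Rightarrow> real"
  shows "(\<Sum>x\<in>patterns N M. \<Prod>\<nu>=1..M. \<phi> (\<lambda>i\<in>{1..N}. x i \<nu>)) = (\<Sum>c\<in>spin_configs N. \<phi> c) ^ M"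
proof -
  have "(\<Sum>c\<in>spin_configs N. \<phi> c) ^ M = (\<Prod>\<nu>=1..M. \<Sum>c\<in>spin_configs N. \<phi> c)"
    by simp
  also have "\<dots> = (\<Sum>y\<in>patterns M N. \<Prod>\<nu>=1..M. \<phi> (y \<nu>))"
    by (intro prod_sum_PiE[where f = "\<lambda>_. \<phi>"]) (auto simp: finite_spin_configs)
  also have "\<dots> = (\<Sum>x\<in>patterns N M. \<Prod>\<nu>=1..M. \<phi> (\<lambda>i\<in>{1..N}. x i \<nu>))"
  proof (rule sum.reindex_bij_witness[where i = "transpose_pattern M N" and j = "transpose_pattern N M"])
    fix y assume y: "y \<in> patterns M N"
    have "(\<lambda>i\<in>{1..N}. transpose_pattern N M y i \<nu>) = transpose_pattern M N (transpose_pattern N M y) \<nu>"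
      if "\<nu> \<in> {1..M}" for \<nu>
      using that by (simp add: transpose_pattern_def)
    then show "(\<Prod>\<nu>=1..M. \<phi> (\<lambda>i\<in>{1..N}. transpose_pattern N M y i \<nu>)) = (\<Prod>\<nu>=1..M. \<phi> (y \<nu>))"
      by (intro prod.cong refl) (simp only: transpose_pattern_twice[OF y])
  qed (simp_all only: transpose_pattern_mem transpose_pattern_twice)
  finally show ?thesis by simp
qed

text \<open>The inverse temperature is split off because both \<open>\<beta>\<close> and
  \<open>\<beta>'\<close> are applied to the same energy.\<close>

definition energy :: "nat \<Rightarrow> nat \<Rightarrow> (nat \<Rightarrow> nat \<Rightarrow> real) \<Rightarrow> (nat \<Rightarrow> real) \<Rightarrow> real" where
  "energy N M x \<sigma> = real N / 2 * (L2_set (overlap N x \<sigma>) {1..M})\<^sup>2"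

lemma gibbs_weight_energy: "gibbs_weight \<beta> N M x \<sigma> = exp (\<beta> * energy N M x \<sigma>)"
  by (simp add: gibbs_weight_def energy_def)

lemma energy_nonneg: "0 \<le> energy N M x \<sigma>"
  by (simp add: energy_def)

lemma energy_eq: "energy N M x \<sigma> = (\<Sum>\<nu>=1..M. (\<Sum>i=1..N. \<sigma> i * x i \<nu>)\<^sup>2 / (2 * real N))"
proof (cases "N = 0")
  case False
  then have "real N / 2 * (1 / real N * s)\<^sup>2 = s\<^sup>2 / (2 * real N)" for s
    by (simp add: power_mult_distrib power_divide power2_eq_square)
  then show ?thesis
    by (simp only: energy_def L2_set_def overlap_def real_sqrt_pow2 sum_nonneg zero_le_power2
        sum_distrib_left[where A = "{1..M}"])
qed (simp add: energy_def)

text \<open>The two averages are exchanged: for fixed \<open>\<sigma>\<close> the disorder average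
  is a product over \<open>M\<close> independent columns, and each factor is bounded uniformly in
  \<open>\<sigma>\<close> and \<open>N\<close>.\<close>

lemma avg_partition_le:
  assumes \<beta>: "0 \<le> \<beta>" "\<beta> < 1" and "0 < N"
  shows "avg (patterns N M) (\<lambda>x. avg (spin_configs N) (\<lambda>\<sigma>. exp (\<beta> * energy N M x \<sigma>)))
    \<le> (1 / sqrt (1 - \<beta>)) ^ M"
proof -
  have "avg (patterns N M) (\<lambda>x. exp (\<beta> * energy N M x \<sigma>)) \<le> (1 / sqrt (1 - \<beta>)) ^ M"
    if \<sigma>: "\<sigma> \<in> spin_configs N" for \<sigma>
  proof -
    define \<phi> where "\<phi> = (\<lambda>c. exp (\<beta> / (2 * real N) * (\<Sum>i=1..N. \<sigma> i * c i)\<^sup>2))"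
    have "exp (\<beta> * energy N M x \<sigma>) = (\<Prod>\<nu>=1..M. \<phi> (\<lambda>i\<in>{1..N}. x i \<nu>))" for x
      by (simp add: energy_eq \<phi>_def exp_sum sum_distrib_left)
    then have "avg (patterns N M) (\<lambda>x. exp (\<beta> * energy N M x \<sigma>)) = avg (spin_configs N) \<phi> ^ M"
      by (simp add: avg_def sum_patterns_prod_columns card_patterns card_spin_configs
          power_divide power_mult[symmetric] mult.commute[of M] del: One_nat_def)
    also have "\<dots> \<le> (1 / sqrt (1 - \<beta>)) ^ M"
      unfolding \<phi>_def
      by (intro power_mono avg_spin_configs_exp_square assms \<sigma> avg_nonneg) auto
    finally show ?thesis .
  qed
  then have "avg (spin_configs N) (\<lambda>\<sigma>. avg (patterns N M) (\<lambda>x. exp (\<beta> * energy N M x \<sigma>)))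
      \<le> avg (spin_configs N) (\<lambda>_. (1 / sqrt (1 - \<beta>)) ^ M)"
    by (rule avg_mono)
  then show ?thesis
    by (subst avg_swap) (simp add: avg_const finite_spin_configs spin_configs_nonempty)
qed

subsection \<open>Total variation distance of block marginals\<close>

lemma tv_dist_nonneg: "0 \<le> tv_dist p q"
  unfolding tv_dist_def by (rule cSUP_upper2[OF tv_dist_bdd UNIV_I abs_ge_zero])

text \<open>Some event exceeds half of a positive supremum; the factor 2 avoids the question whether
  the supremum is attained.\<close>

lemma tv_dist_le_twice_difference:
  obtains A where "tv_dist p q \<le> 2 * \<bar>measure_pmf.prob p A - measure_pmf.prob q A\<bar>"
proof (cases "tv_dist p q = 0")
  case True
  then show ?thesis using that[of "{}"] by simp
next
  case False
  then have "tv_dist p q / 2 < tv_dist p q" using tv_dist_nonneg[of p q] by simp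
  then obtain A where "tv_dist p q / 2 < \<bar>measure_pmf.prob p A - measure_pmf.prob q A\<bar>"
    using less_cSUP_iff[OF _ tv_dist_bdd[of p q]] unfolding tv_dist_def by blast
  then show ?thesis using that[of A] by simp
qed

lemma rademacher_power_eq: "rademacher_power N = pmf_of_set (spin_configs N)"
proof -
  have "PiE_dflt {1..N} undefined (\<lambda>_. {-1, 1 :: real}) = spin_configs N"
    unfolding PiE_dflt_def spin_configs_def PiE_def Pi_def extensional_def by blast
  then show ?thesis
    unfolding rademacher_power_def rademacher_def by (subst Pi_pmf_of_set) auto
qed

lemma rademacher_power_restrict:
  assumes "k \<le> N"
  shows "rademacher_power k = map_pmf (\<lambda>\<sigma>. restrict \<sigma> {1..k}) (rademacher_power N)"
  unfolding rademacher_power_def restrict_def using assms by (intro Pi_pmf_subset) auto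

text \<open>Events on \<open>k\<close> spins are lifted to \<open>N\<close> spins, where they can be
  compared with the Gibbs measure.\<close>

lemma prob_rademacher_power:
  assumes "k \<le> N"
  shows "measure_pmf.prob (rademacher_power k) A
    = avg (spin_configs N) (\<lambda>\<sigma>. indicator A (restrict \<sigma> {1..k}))"
proof -
  have "(\<Sum>\<sigma>\<in>spin_configs N. indicator A (restrict \<sigma> {1..k}) :: real)
      = real (card (spin_configs N \<inter> (\<lambda>\<sigma>. restrict \<sigma> {1..k}) -` A))"
    by (simp add: indicator_def sum_of_bool_eq finite_spin_configs vimage_def)
  then show ?thesis
    by (subst rademacher_power_restrict[OF assms]) (simp add: rademacher_power_eq avg_def
        measure_pmf_of_set[OF spin_configs_nonempty finite_spin_configs])
qed

text \<open>The test function is the lifted indicator of a near-optimal event, centred under the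
  uniform law and given the sign of the discrepancy; its mean under \<open>p\<close> is then the
  absolute discrepancy.\<close>

lemma marginal_test_function:
  assumes "k \<le> N" and p: "set_pmf p \<subseteq> spin_configs N"
  shows "\<exists>f. (\<forall>\<sigma>. \<bar>f \<sigma>\<bar> \<le> 1) \<and> depends_on f {1..k} \<and> avg (spin_configs N) f = 0 \<and>
    tv_dist (map_pmf (\<lambda>\<sigma>. restrict \<sigma> {1..k}) p) (rademacher_power k)
      \<le> 2 * (\<Sum>\<sigma>\<in>spin_configs N. pmf p \<sigma> * f \<sigma>)"
proof -
  let ?r = "\<lambda>\<sigma> :: nat \<Rightarrow> real. restrict \<sigma> {1..k}"
  obtain A where A: "tv_dist (map_pmf ?r p) (rademacher_power k)
      \<le> 2 * \<bar>measure_pmf.prob (map_pmf ?r p) A - measure_pmf.prob (rademacher_power k) A\<bar>"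
    by (rule tv_dist_le_twice_difference)
  define q where "q = measure_pmf.prob (rademacher_power k) A"
  define d where "d = measure_pmf.prob (map_pmf ?r p) A - q"
  define s where "s = (if 0 \<le> d then 1 else - 1 :: real)"
  define f where "f = (\<lambda>\<sigma>. s * indicator A (?r \<sigma>) + - s * q)"
  have sum1: "(\<Sum>\<sigma>\<in>spin_configs N. pmf p \<sigma>) = 1"
    by (rule sum_pmf_eq_1[OF finite_spin_configs p])
  have "measure_pmf.prob (map_pmf ?r p) A = measure_pmf.prob p (?r -` A \<inter> spin_configs N)"
    unfolding measure_map_pmf using p by (intro measure_prob_cong_0) (auto simp: set_pmf_eq)
  also have "\<dots> = (\<Sum>\<sigma>\<in>?r -` A \<inter> spin_configs N. pmf p \<sigma>)"
    by (intro measure_measure_pmf_finite finite_Int) (simp add: finite_spin_configs)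
  also have "\<dots> = (\<Sum>\<sigma>\<in>spin_configs N. pmf p \<sigma> * indicator A (?r \<sigma>))"
    by (intro sum.mono_neutral_cong_left finite_spin_configs) (auto simp: indicator_def)
  finally have "(\<Sum>\<sigma>\<in>spin_configs N. pmf p \<sigma> * f \<sigma>) = s * d"
    by (simp add: f_def d_def distrib_left right_diff_distrib sum.distrib sum_subtractf mult.left_commute
        sum_distrib_left[symmetric] sum_distrib_right[symmetric] sum1)
  also have "\<dots> = \<bar>d\<bar>" by (simp add: s_def)
  finally have 1: "(\<Sum>\<sigma>\<in>spin_configs N. pmf p \<sigma> * f \<sigma>) = \<bar>d\<bar>" .
  have "0 \<le> q" "q \<le> 1" by (simp_all add: q_def)
  then have 2: "\<bar>f \<sigma>\<bar> \<le> 1" for \<sigma>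
    by (auto simp: f_def s_def indicator_def abs_le_iff)
  have 3: "depends_on f {1..k}"
    unfolding depends_on_def f_def by (auto cong: restrict_cong)
  have 4: "avg (spin_configs N) f = 0"
    unfolding f_def avg_add avg_cmult avg_const[OF finite_spin_configs spin_configs_nonempty]
    by (simp add: q_def prob_rademacher_power[OF assms(1)])
  show ?thesis
    using 2 3 4 A unfolding d_def[symmetric] q_def[symmetric] 1[symmetric] by blast
qed

section \<open>Invariance under permutations of the sites\<close>

definition index_involution :: "nat \<Rightarrow> (nat \<Rightarrow> nat) \<Rightarrow> bool" where
  "index_involution N \<tau> \<longleftrightarrow> (\<forall>i. \<tau> (\<tau> i) = i) \<and> (\<forall>i. \<tau> i \<in> {1..N} \<longleftrightarrow> i \<in> {1..N})"

text \<open>An index involution also preserves the complement of \<open>{1..N}\<close>, so the value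
  \<open>undefined\<close> stays in its place.\<close>

lemma comp_index_involution_mem:
  assumes "index_involution N \<tau>" "x \<in> {1..N} \<rightarrow>\<^sub>E B"
  shows "x \<circ> \<tau> \<in> {1..N} \<rightarrow>\<^sub>E B"
proof (rule PiE_I)
  have iff: "\<tau> i \<in> {1..N} \<longleftrightarrow> i \<in> {1..N}" for i
    using assms(1) by (simp only: index_involution_def)
  show "(x \<circ> \<tau>) i \<in> B" if "i \<in> {1..N}" for i
    using PiE_mem[OF assms(2), of "\<tau> i"] that iff[of i] by (simp only: o_apply)
  show "(x \<circ> \<tau>) i = undefined" if "i \<notin> {1..N}" for i
    using PiE_arb[OF assms(2), of "\<tau> i"] that iff[of i] by (metis o_apply)
qed

lemma comp_index_involution_twice: "index_involution N \<tau> \<Longrightarrow> (x \<circ> \<tau>) \<circ> \<tau> = x"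
  by (simp add: index_involution_def fun_eq_iff)

lemma avg_comp_index_involution:
  assumes "index_involution N \<tau>"
  shows "avg ({1..N} \<rightarrow>\<^sub>E B) (\<lambda>x. f (x \<circ> \<tau>)) = avg ({1..N} \<rightarrow>\<^sub>E B) f"
  by (rule avg_reindex_involution[where h = "\<lambda>x. x \<circ> \<tau>"])
    (rule comp_index_involution_mem[OF assms] comp_index_involution_twice[OF assms], assumption?)+

lemma sum_spin_configs_comp_index_involution:
  assumes "index_involution N \<tau>"
  shows "(\<Sum>\<sigma>\<in>spin_configs N. f (\<sigma> \<circ> \<tau>)) = (\<Sum>\<sigma>\<in>spin_configs N. f \<sigma>)"
  by (rule sum.reindex_bij_witness[where i = "\<lambda>\<sigma>. \<sigma> \<circ> \<tau>" and j = "\<lambda>\<sigma>. \<sigma> \<circ> \<tau>"])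
    (simp_all only: spin_configs_def comp_index_involution_mem[OF assms]
      comp_index_involution_twice[OF assms])

lemma overlap_comp_index_involution:
  assumes "index_involution N \<tau>"
  shows "overlap N (x \<circ> \<tau>) (\<sigma> \<circ> \<tau>) = overlap N x \<sigma>"
proof
  fix \<nu>
  have "(\<Sum>i=1..N. \<sigma> (\<tau> i) * x (\<tau> i) \<nu>) = (\<Sum>i=1..N. \<sigma> i * x i \<nu>)"
    by (rule sum.reindex_bij_witness[where i = \<tau> and j = \<tau>])
      (use assms in \<open>simp_all only: index_involution_def\<close>)
  then show "overlap N (x \<circ> \<tau>) (\<sigma> \<circ> \<tau>) \<nu> = overlap N x \<sigma> \<nu>"
    by (simp add: overlap_def)
qed

text \<open>Relabelling the sites in disorder and configuration together leaves the overlaps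
  unchanged. A test on a distant block thus becomes a test on the first block under relabelled
  disorder.\<close>

lemma sum_gibbs_comp_index_involution:
  assumes \<tau>: "index_involution N \<tau>"
  shows "(\<Sum>\<sigma>\<in>spin_configs N. pmf (gibbs \<beta> N M x) \<sigma> * f (\<sigma> \<circ> \<tau>))
    = (\<Sum>\<sigma>\<in>spin_configs N. pmf (gibbs \<beta> N M (x \<circ> \<tau>)) \<sigma> * f \<sigma>)"
proof -
  have w: "gibbs_weight \<beta> N M (x \<circ> \<tau>) (\<sigma> \<circ> \<tau>) = gibbs_weight \<beta> N M x \<sigma>" for \<sigma>
    by (simp only: gibbs_weight_def overlap_comp_index_involution[OF \<tau>])
  have Z: "partition_function \<beta> N M (x \<circ> \<tau>) = partition_function \<beta> N M x"
    unfolding partition_function_def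
    by (subst sum_spin_configs_comp_index_involution[OF \<tau>, symmetric]) (simp only: w)
  have "pmf (gibbs \<beta> N M x) \<sigma> = pmf (gibbs \<beta> N M (x \<circ> \<tau>)) (\<sigma> \<circ> \<tau>)" if "\<sigma> \<in> spin_configs N" for \<sigma>
    using that comp_index_involution_mem[OF \<tau>, of \<sigma>] by (simp add: pmf_gibbs w Z spin_configs_def)
  then have "(\<Sum>\<sigma>\<in>spin_configs N. pmf (gibbs \<beta> N M x) \<sigma> * f (\<sigma> \<circ> \<tau>))
      = (\<Sum>\<sigma>\<in>spin_configs N. pmf (gibbs \<beta> N M (x \<circ> \<tau>)) (\<sigma> \<circ> \<tau>) * f (\<sigma> \<circ> \<tau>))"
    by (intro sum.cong) auto
  also have "\<dots> = (\<Sum>\<sigma>\<in>spin_configs N. pmf (gibbs \<beta> N M (x \<circ> \<tau>)) \<sigma> * f \<sigma>)"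
    by (rule sum_spin_configs_comp_index_involution[OF \<tau>])
  finally show ?thesis .
qed

text \<open>Exchange of the first block with block \<open>j\<close>, where blocks are counted from 0
  and \<open>j = 0\<close> gives the identity.\<close>

definition block_swap :: "nat \<Rightarrow> nat \<Rightarrow> nat \<Rightarrow> nat" where
  "block_swap k j i = (if i \<in> {1..k} then i + j * k
     else if i \<in> {j * k + 1..j * k + k} then i - j * k else i)"

lemma index_involution_block_swap:
  assumes "j < n" "n * k \<le> N"
  shows "index_involution N (block_swap k j)"
proof -
  define m where "m = j * k"
  have "(j + 1) * k \<le> n * k" using assms(1) by (intro mult_right_mono) auto
  then have "m + k \<le> N" using assms(2) by (simp add: m_def)
  \<comment> \<open>Either the two blocks coincide or they are disjoint.\<close>
  moreover have "m = 0 \<or> k \<le> m" unfolding m_def by (cases j) auto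
  ultimately show ?thesis
    unfolding index_involution_def block_swap_def m_def[symmetric] by (elim disjE) auto
qed

lemma block_disjoint:
  fixes i j k :: nat
  assumes "i \<noteq> j"
  shows "{i * k + 1..i * k + k} \<inter> {j * k + 1..j * k + k} = {}"
proof -
  have *: "{i * k + 1..i * k + k} \<inter> {j * k + 1..j * k + k} = {}" if "i < j" for i j
  proof -
    have "(i + 1) * k \<le> j * k" using that by (intro mult_right_mono) auto
    then show ?thesis by auto
  qed
  show ?thesis using *[of i j] *[of j i] assms by (cases "i < j") auto
qed

text \<open>
  The tested function adds up, over disjoint blocks, near-optimal test functions for the total
  variation distance of each block marginal; under the uniform law the blocks are independent.
\<close>

lemma sum_tv_dist_block_le:
  assumes \<beta>: "0 < \<beta>" "\<beta> < \<beta>'" and k: "k \<le> N" "n * k \<le> N" and c: "0 \<le> c" "c \<le> 1"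
  shows "c / 2 * (\<Sum>j<n. tv_dist (gibbs_marginal \<beta> N M k (x \<circ> block_swap k j)) (rademacher_power k))
    \<le> \<beta> / (\<beta>' - \<beta>) * ln (avg (spin_configs N) (\<lambda>\<sigma>. exp (\<beta>' * energy N M x \<sigma>))) + real n * c\<^sup>2"
proof -
  let ?A = "spin_configs N"
  let ?\<tau> = "block_swap k"
  let ?tv = "\<lambda>y. tv_dist (gibbs_marginal \<beta> N M k y) (rademacher_power k)"
  have set: "set_pmf (gibbs \<beta> N M y) \<subseteq> ?A" for y
    by (auto simp: set_pmf_eq pmf_gibbs)
  \<comment> \<open>A test function is fixed for every disorder \<open>y\<close>, so that block
    \<open>j\<close> can use the one belonging to \<open>x \<circ> block_swap k j\<close>.\<close>
  have "\<forall>y. \<exists>f. (\<forall>\<sigma>. \<bar>f \<sigma>\<bar> \<le> 1) \<and> depends_on f {1..k} \<and> avg ?A f = 0 \<and>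
      ?tv y \<le> 2 * (\<Sum>\<sigma>\<in>?A. pmf (gibbs \<beta> N M y) \<sigma> * f \<sigma>)"
    unfolding gibbs_marginal_def by (intro allI marginal_test_function k set)
  from choice[OF this] obtain f where f: "\<And>y \<sigma>. \<bar>f y \<sigma>\<bar> \<le> 1" "\<And>y. depends_on (f y) {1..k}"
      "\<And>y. avg ?A (f y) = 0" "\<And>y. ?tv y \<le> 2 * (\<Sum>\<sigma>\<in>?A. pmf (gibbs \<beta> N M y) \<sigma> * f y \<sigma>)"
    by blast
  \<comment> \<open>Moving block \<open>j\<close> to the front makes \<open>F j\<close> a function
    of the spins of block \<open>j\<close> alone.\<close>
  define F where "F = (\<lambda>j \<sigma>. f (x \<circ> ?\<tau> j) (\<sigma> \<circ> ?\<tau> j))"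
  define \<psi> where "\<psi> = (\<lambda>\<sigma>. \<Sum>j<n. c * F j \<sigma>)"
  have "c / 2 * (\<Sum>j<n. ?tv (x \<circ> ?\<tau> j)) \<le> (\<Sum>j<n. c * (\<Sum>\<sigma>\<in>?A. pmf (gibbs \<beta> N M x) \<sigma> * F j \<sigma>))"
    unfolding sum_distrib_left
  proof (rule sum_mono)
    fix j assume "j \<in> {..<n}"
    then have \<tau>: "index_involution N (?\<tau> j)" using k by (intro index_involution_block_swap) auto
    have "?tv (x \<circ> ?\<tau> j) \<le> 2 * (\<Sum>\<sigma>\<in>?A. pmf (gibbs \<beta> N M x) \<sigma> * F j \<sigma>)"
      unfolding F_def sum_gibbs_comp_index_involution[OF \<tau>] by (rule f(4))
    then have "c / 2 * ?tv (x \<circ> ?\<tau> j) \<le> c / 2 * (2 * (\<Sum>\<sigma>\<in>?A. pmf (gibbs \<beta> N M x) \<sigma> * F j \<sigma>))"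
      using c by (intro mult_left_mono) auto
    then show "c / 2 * ?tv (x \<circ> ?\<tau> j) \<le> (\<Sum>\<sigma>\<in>?A. c * (pmf (gibbs \<beta> N M x) \<sigma> * F j \<sigma>))"
      by (simp add: sum_distrib_left)
  qed
  also have "\<dots> = (\<Sum>\<sigma>\<in>?A. pmf (gibbs \<beta> N M x) \<sigma> * \<psi> \<sigma>)"
    unfolding \<psi>_def sum_distrib_left by (subst sum.swap) (simp add: mult.left_commute)
  also have "\<dots> \<le> \<beta> / (\<beta>' - \<beta>) * ln (avg ?A (\<lambda>\<sigma>. exp (\<beta>' * energy N M x \<sigma>)))
      + ln (avg ?A (\<lambda>\<sigma>. exp (\<psi> \<sigma>)))"
    by (intro gibbs_sum_le finite_spin_configs spin_configs_nonempty energy_nonneg \<beta>)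
      (simp add: pmf_gibbs partition_function_def gibbs_weight_energy)
  also have "ln (avg ?A (\<lambda>\<sigma>. exp (\<psi> \<sigma>))) \<le> real n * c\<^sup>2"
  proof -
    have "avg ?A (\<lambda>\<sigma>. exp (\<psi> \<sigma>)) = avg ?A (\<lambda>\<sigma>. \<Prod>j<n. exp (c * F j \<sigma>))"
      by (simp add: \<psi>_def exp_sum)
    also have "\<dots> = (\<Prod>j<n. avg ?A (\<lambda>\<sigma>. exp (c * F j \<sigma>)))"
      unfolding spin_configs_def
    proof (rule avg_prod_depends_on)
      show "{i * k + 1..i * k + k} \<inter> {j * k + 1..j * k + k} = {}" if "i \<noteq> j" for i j
        using that by (rule block_disjoint)
      show "depends_on (\<lambda>\<sigma>. exp (c * F j \<sigma>)) {j * k + 1..j * k + k}" for j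
        unfolding depends_on_def
      proof (intro allI impI)
        fix \<sigma> \<sigma>' :: "nat \<Rightarrow> real"
        assume *: "\<forall>i\<in>{j * k + 1..j * k + k}. \<sigma> i = \<sigma>' i"
        have "F j \<sigma> = F j \<sigma>'"
          unfolding F_def by (rule depends_onD[OF f(2)]) (use * in \<open>auto simp: block_swap_def\<close>)
        then show "exp (c * F j \<sigma>) = exp (c * F j \<sigma>')" by simp
      qed
    qed auto
    also have "\<dots> \<le> (\<Prod>j<n. exp (c\<^sup>2))"
    proof (intro prod_mono conjI)
      fix j assume "j \<in> {..<n}"
      then have \<tau>: "index_involution N (?\<tau> j)" using k by (intro index_involution_block_swap) auto
      have "avg ?A (\<lambda>\<sigma>. exp (c * F j \<sigma>)) = avg ?A (\<lambda>\<sigma>. exp (c * f (x \<circ> ?\<tau> j) \<sigma>))"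
        unfolding F_def spin_configs_def by (rule avg_comp_index_involution[OF \<tau>])
      also have "\<dots> \<le> exp (c\<^sup>2)"
        by (intro avg_exp_le finite_spin_configs spin_configs_nonempty f c)
      finally show "avg ?A (\<lambda>\<sigma>. exp (c * F j \<sigma>)) \<le> exp (c\<^sup>2)" .
    qed (simp add: avg_nonneg)
    also have "\<dots> = exp (real n * c\<^sup>2)"
      by (simp add: exp_of_nat_mult)
    finally have "avg ?A (\<lambda>\<sigma>. exp (\<psi> \<sigma>)) \<le> exp (real n * c\<^sup>2)" .
    moreover have "0 < avg ?A (\<lambda>\<sigma>. exp (\<psi> \<sigma>))"
      by (intro avg_pos finite_spin_configs spin_configs_nonempty) auto
    ultimately show ?thesis
      by (metis ln_exp ln_le_cancel_iff exp_gt_zero)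
  qed
  finally show ?thesis by simp
qed

text \<open>The uniform law of the disorder is invariant under block swaps, so all \<open>n\<close>
  blocks contribute equally. Jensen's inequality brings in the annealed bound. The strength
  \<open>c\<close> of the test functions stays free, to be balanced later.\<close>

lemma avg_tv_dist_le:
  assumes \<beta>: "0 < \<beta>" "\<beta> < \<beta>'" "\<beta>' < 1" and "0 < N" and k: "k \<le> N" "n * k \<le> N"
    and c: "0 \<le> c" "c \<le> 1"
  shows "c / 2 * (real n * avg (patterns N M) (\<lambda>x. tv_dist (gibbs_marginal \<beta> N M k x) (rademacher_power k)))
    \<le> \<beta> / (\<beta>' - \<beta>) * (real M * ln (1 / sqrt (1 - \<beta>'))) + real n * c\<^sup>2"
proof -
  let ?X = "patterns N M"
  let ?tv = "\<lambda>y. tv_dist (gibbs_marginal \<beta> N M k y) (rademacher_power k)"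
  let ?L = "\<lambda>x. ln (avg (spin_configs N) (\<lambda>\<sigma>. exp (\<beta>' * energy N M x \<sigma>)))"
  have "avg ?X (\<lambda>x. ?tv (x \<circ> block_swap k j)) = avg ?X ?tv" if "j \<in> {..<n}" for j
    using that k by (intro avg_comp_index_involution index_involution_block_swap) auto
  then have "c / 2 * (real n * avg ?X ?tv) = c / 2 * (\<Sum>j<n. avg ?X (\<lambda>x. ?tv (x \<circ> block_swap k j)))"
    by simp
  also have "\<dots> = avg ?X (\<lambda>x. c / 2 * (\<Sum>j<n. ?tv (x \<circ> block_swap k j)))"
    by (simp only: avg_cmult avg_sum)
  also have "\<dots> \<le> avg ?X (\<lambda>x. \<beta> / (\<beta>' - \<beta>) * ?L x + real n * c\<^sup>2)"
    using \<beta> k c by (intro avg_mono sum_tv_dist_block_le)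
  also have "\<dots> = \<beta> / (\<beta>' - \<beta>) * avg ?X ?L + real n * c\<^sup>2"
    by (simp only: avg_add avg_cmult avg_const[OF finite_patterns patterns_nonempty])
  finally have 1: "c / 2 * (real n * avg ?X ?tv) \<le> \<beta> / (\<beta>' - \<beta>) * avg ?X ?L + real n * c\<^sup>2" .
  have "avg ?X ?L \<le> ln ((1 / sqrt (1 - \<beta>')) ^ M)"
    using \<beta> \<open>0 < N\<close>
    by (intro avg_ln_le avg_partition_le avg_pos finite_patterns patterns_nonempty
        finite_spin_configs spin_configs_nonempty) auto
  also have "\<dots> = real M * ln (1 / sqrt (1 - \<beta>'))"
    by (rule ln_realpow)
  finally have "\<beta> / (\<beta>' - \<beta>) * avg ?X ?L \<le> \<beta> / (\<beta>' - \<beta>) * (real M * ln (1 / sqrt (1 - \<beta>')))"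
    using \<beta> by (intro mult_left_mono) auto
  with 1 show ?thesis by linarith
qed

subsection \<open>The law of the disorder\<close>

text \<open>For a sign variable the indicator of the value \<open>s\<close> is the affine function
  \<open>1 / 2 + s / 2 * \<xi> i \<omega> \<nu>\<close>, so the mean determines the law.\<close>

lemma (in hopfield_disorder) prob_coordinate:
  assumes i: "i \<in> {1..N}" and \<nu>: "\<nu> \<in> {1..M}" and s: "s \<in> {-1, 1}"
  shows "prob ((\<lambda>\<omega>. \<xi> i \<omega> \<nu>) -` {s} \<inter> space P) = 1 / 2"
proof -
  have [measurable]: "(\<lambda>\<omega>. \<xi> i \<omega> \<nu>) \<in> borel_measurable P"
    using indep_coordinates[OF i] \<nu> by (auto simp: indep_vars_def)
  have val: "\<xi> i \<omega> \<nu> = -1 \<or> \<xi> i \<omega> \<nu> = 1" if "\<omega> \<in> space P" for \<omega>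
    using spin_configs_values[OF disorder_values[OF i that] \<nu>] .
  have "norm (\<xi> i \<omega> \<nu>) \<le> 1" if "\<omega> \<in> space P" for \<omega>
    using val[OF that] by auto
  then have int: "integrable P (\<lambda>\<omega>. \<xi> i \<omega> \<nu>)"
    by (intro integrable_const_bound[where B = 1] AE_I2) auto
  have "prob ((\<lambda>\<omega>. \<xi> i \<omega> \<nu>) -` {s} \<inter> space P)
      = expectation (indicator ((\<lambda>\<omega>. \<xi> i \<omega> \<nu>) -` {s} \<inter> space P))"
    by simp
  also have "\<dots> = expectation (\<lambda>\<omega>. 1 / 2 + s / 2 * \<xi> i \<omega> \<nu>)"
  proof (rule Bochner_Integration.integral_cong)
    fix \<omega> assume "\<omega> \<in> space P"
    then show "indicator ((\<lambda>\<omega>. \<xi> i \<omega> \<nu>) -` {s} \<inter> space P) \<omega> = 1 / 2 + s / 2 * \<xi> i \<omega> \<nu>"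
      using val[of \<omega>] s by (auto simp: indicator_def)
  qed simp
  also have "\<dots> = 1 / 2"
    using int mean_zero[OF i \<nu>] by (simp add: prob_space)
  finally show ?thesis .
qed

lemma (in hopfield_disorder) vector_events:
  assumes "i \<in> {1..N}" "c \<in> spin_configs M"
  shows "\<xi> i -` {c} \<inter> space P \<in> events" "{c} \<in> sets (\<Pi>\<^sub>M \<nu>\<in>{1..M}. borel)"
proof -
  have "(\<Pi>\<^sub>E \<nu>\<in>{1..M}. {c \<nu>}) \<in> sets (\<Pi>\<^sub>M \<nu>\<in>{1..M}. borel)"
    by (intro sets_PiM_I_finite) auto
  moreover have "(\<Pi>\<^sub>E \<nu>\<in>{1..M}. {c \<nu>}) = {c}"
    using assms(2) unfolding spin_configs_def by (intro PiE_singleton) (simp only: PiE_iff)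
  ultimately show c: "{c} \<in> sets (\<Pi>\<^sub>M \<nu>\<in>{1..M}. borel)" by (simp only:)
  have "\<xi> i \<in> measurable P (\<Pi>\<^sub>M \<nu>\<in>{1..M}. borel)"
    using indep_vectors assms(1) by (auto simp: indep_vars_def)
  then show "\<xi> i -` {c} \<inter> space P \<in> events"
    using c by (rule measurable_sets)
qed

lemma (in hopfield_disorder) prob_vector:
  assumes i: "i \<in> {1..N}" and c: "c \<in> spin_configs M"
  shows "prob (\<xi> i -` {c} \<inter> space P) = 1 / 2 ^ M"
proof (cases "M = 0")
  \<comment> \<open>Here every vector is \<open>undefined\<close> throughout, and the intersection
    over coordinates used below would be \<open>UNIV\<close> instead of
    \<open>space P\<close>.\<close>
  case True
  then have "\<xi> i -` {c} \<inter> space P = space P"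
    using disorder_values[OF i] c by (auto simp: spin_configs_def)
  then show ?thesis using True by (simp add: prob_space)
next
  case False
  have "\<xi> i -` {c} \<inter> space P = (\<Inter>\<nu>\<in>{1..M}. (\<lambda>\<omega>. \<xi> i \<omega> \<nu>) -` {c \<nu>} \<inter> space P)" (is "?L = ?R")
  proof
    show "?L \<subseteq> ?R" by auto
    show "?R \<subseteq> ?L"
    proof
      fix \<omega> assume \<omega>: "\<omega> \<in> ?R"
      have "\<omega> \<in> space P" using \<omega> False by (auto simp: Suc_le_eq)
      moreover have "\<xi> i \<omega> = c"
        using disorder_values[OF i \<open>\<omega> \<in> space P\<close>] c \<omega> unfolding spin_configs_def
        by (intro PiE_ext) auto
      ultimately show "\<omega> \<in> ?L" by simp
    qed
  qed
  also have "prob \<dots> = (\<Prod>\<nu>\<in>{1..M}. prob ((\<lambda>\<omega>. \<xi> i \<omega> \<nu>) -` {c \<nu>} \<inter> space P))"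
    by (rule indep_varsD_finite[OF indep_coordinates[OF i]]) (use False in auto)
  also have "\<dots> = (\<Prod>\<nu>\<in>{1..M}. 1 / 2)"
  proof (rule prod.cong)
    fix \<nu> assume \<nu>: "\<nu> \<in> {1..M}"
    show "prob ((\<lambda>\<omega>. \<xi> i \<omega> \<nu>) -` {c \<nu>} \<inter> space P) = 1 / 2"
      using spin_configs_values[OF c \<nu>] by (intro prob_coordinate i \<nu>) auto
  qed simp
  finally show ?thesis by (simp add: power_one_over)
qed

text \<open>The disorder is uniform on sign matrices. The restriction fixes the value outside
  \<open>{1..N}\<close>, where the locale leaves \<open>\<xi>\<close> arbitrary.\<close>

lemma (in hopfield_disorder) prob_patterns:
  assumes "0 < N"
  shows "prob {\<omega> \<in> space P. Q (\<lambda>i\<in>{1..N}. \<xi> i \<omega>)} = avg (patterns N M) (\<lambda>x. of_bool (Q x))"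
proof -
  define E where "E = (\<lambda>x. \<Inter>i\<in>{1..N}. \<xi> i -` {x i} \<inter> space P)"
  have ne: "{1..N} \<noteq> {}" using assms by simp
  have E_iff: "\<omega> \<in> E x \<longleftrightarrow> \<omega> \<in> space P \<and> (\<lambda>i\<in>{1..N}. \<xi> i \<omega>) = x" if "x \<in> patterns N M" for x \<omega>
  proof -
    have "(\<lambda>i\<in>{1..N}. \<xi> i \<omega>) = x \<longleftrightarrow> (\<forall>i\<in>{1..N}. \<xi> i \<omega> = x i)"
      using that by (metis PiE_restrict restrict_apply' restrict_ext)
    then show ?thesis using ne unfolding E_def by blast
  qed
  have E_events: "E x \<in> events" if "x \<in> patterns N M" for x
    unfolding E_def using that ne vector_events(1) by (intro sets.finite_INT) (auto dest: PiE_mem)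
  have E_prob: "prob (E x) = 1 / real (card (patterns N M))" if x: "x \<in> patterns N M" for x
  proof -
    have "prob (E x) = (\<Prod>i\<in>{1..N}. prob (\<xi> i -` {x i} \<inter> space P))"
      unfolding E_def by (rule indep_varsD_finite[OF indep_vectors])
        (use ne vector_events(2) PiE_mem[OF x] in auto)
    also have "\<dots> = (\<Prod>i\<in>{1..N}. 1 / 2 ^ M)"
      using PiE_mem[OF x] by (intro prod.cong prob_vector) auto
    finally show ?thesis
      unfolding card_patterns by (simp add: power_one_over)
  qed
  have mem: "(\<lambda>i\<in>{1..N}. \<xi> i \<omega>) \<in> patterns N M" if "\<omega> \<in> space P" for \<omega>
    using disorder_values[OF _ that] by (intro restrict_PiE_iff[THEN iffD2]) blast
  \<comment> \<open>A finite disjoint union of the atoms \<open>E x\<close>, hence an event for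
    every predicate \<open>Q\<close>.\<close>
  have "{\<omega> \<in> space P. Q (\<lambda>i\<in>{1..N}. \<xi> i \<omega>)} = (\<Union>x\<in>{x \<in> patterns N M. Q x}. E x)"
    using mem E_iff by auto
  also have "prob \<dots> = (\<Sum>x\<in>{x \<in> patterns N M. Q x}. prob (E x))"
    using finite_patterns E_events E_iff
    by (intro finite_measure_finite_Union) (auto simp: disjoint_family_on_def)
  also have "\<dots> = (\<Sum>x\<in>{x \<in> patterns N M. Q x}. 1 / real (card (patterns N M)))"
    using E_prob by (intro sum.cong) auto
  also have "\<dots> = avg (patterns N M) (\<lambda>x. of_bool (Q x))"
    using finite_patterns[of N M] by (simp add: avg_def of_bool_def sum.If_cases Int_def)
  finally show ?thesis .
qed

lemma gibbs_marginal_restrict: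
  "gibbs_marginal \<beta> N M k (restrict x {1..N}) = gibbs_marginal \<beta> N M k x"
proof -
  have "overlap N (restrict x {1..N}) \<sigma> = overlap N x \<sigma>" for \<sigma>
    unfolding overlap_def by (intro ext arg_cong2[where f = "(*)"] refl sum.cong) auto
  then show ?thesis
    by (simp only: gibbs_marginal_def gibbs_def partition_function_def gibbs_weight_def)
qed

text \<open>Markov's inequality, applied to the finite average.\<close>

lemma (in hopfield_disorder) prob_tv_dist_le:
  assumes "0 < N" "0 < \<epsilon>"
  shows "prob {\<omega> \<in> space P. \<bar>tv_dist (gibbs_marginal \<beta> N M k (\<lambda>i. \<xi> i \<omega>)) (rademacher_power k) - 0\<bar> > \<epsilon>}
    \<le> avg (patterns N M) (\<lambda>x. tv_dist (gibbs_marginal \<beta> N M k x) (rademacher_power k)) / \<epsilon>"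
proof -
  let ?tv = "\<lambda>x. tv_dist (gibbs_marginal \<beta> N M k x) (rademacher_power k)"
  have "prob {\<omega> \<in> space P. \<bar>?tv (\<lambda>i. \<xi> i \<omega>) - 0\<bar> > \<epsilon>} = avg (patterns N M) (\<lambda>x. of_bool (?tv x > \<epsilon>))"
    using prob_patterns[OF assms(1), of "\<lambda>x. ?tv x > \<epsilon>"]
    by (simp only: gibbs_marginal_restrict tv_dist_nonneg abs_of_nonneg diff_zero)
  also have "\<dots> \<le> avg (patterns N M) (\<lambda>x. 1 / \<epsilon> * ?tv x)"
    using assms(2) tv_dist_nonneg by (intro avg_mono) (auto simp: field_simps)
  also have "\<dots> = avg (patterns N M) ?tv / \<epsilon>"
    unfolding avg_cmult by simp
  finally show ?thesis .
qed

section \<open>Convergence in probability from the averaged bound\<close>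

theorem theorem1p1:
  fixes \<beta> :: real
    and M k :: "nat \<Rightarrow> nat"
    and P :: "nat \<Rightarrow> 'a measure"
    and \<xi> :: "nat \<Rightarrow> nat \<Rightarrow> 'a \<Rightarrow> nat \<Rightarrow> real"
  assumes beta: "0 < \<beta>" "\<beta> < 1"
    and disorder: "\<And>N. N \<ge> 1 \<Longrightarrow> hopfield_disorder (P N) N (M N) (\<xi> N)"
    and M_over_N: "(\<lambda>N. real (M N) / real N) \<longlonglongrightarrow> 0"
    and k_le_N: "\<And>N. N \<ge> 1 \<Longrightarrow> k N \<le> N"
    and k_infinity: "filterlim k at_top sequentially"
    and kM_over_N: "(\<lambda>N. real (k N) * real (M N) / real N) \<longlonglongrightarrow> 0"
  shows "tendsto_in_prob P
           (\<lambda>N \<omega>. tv_dist (gibbs_marginal \<beta> N (M N) (k N) (\<lambda>i. \<xi> N i \<omega>))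
                          (rademacher_power (k N))) 0"
  unfolding tendsto_in_prob_def
proof (intro allI impI)
  fix \<epsilon> :: real
  assume \<epsilon>: "0 < \<epsilon>"
  \<comment> \<open>The midpoint serves as a fixed value strictly between \<open>\<beta>\<close> and
    1.\<close>
  define \<beta>' where "\<beta>' = (\<beta> + 1) / 2"
  have \<beta>': "\<beta> < \<beta>'" "\<beta>' < 1" using beta by (auto simp: \<beta>'_def)
  define C where "C = \<beta> / (\<beta>' - \<beta>) * ln (1 / sqrt (1 - \<beta>'))"
  have C: "0 \<le> C"
    unfolding C_def using beta \<beta>' by (intro mult_nonneg_nonneg divide_nonneg_nonneg ln_ge_zero) auto
  define r where "r = (\<lambda>N. real (k N) * real (M N) / real N)"
  \<comment> \<open>Balancing the entropy term, of order \<open>M N\<close>, against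
    \<open>n * (c N)\<^sup>2\<close> with \<open>n\<close> about \<open>N / k N\<close> suggests
    \<open>(c N)\<^sup>2\<close> of order \<open>r N\<close>; the summand \<open>1 / real N\<close>
    keeps \<open>c N\<close> positive when \<open>M N = 0\<close>.\<close>
  define c where "c = (\<lambda>N. sqrt (r N + 1 / real N))"
  have "(\<lambda>N. r N + 1 / real N) \<longlonglongrightarrow> 0 + 0"
    unfolding r_def by (intro tendsto_add kM_over_N lim_1_over_n)
  then have c_lim: "c \<longlonglongrightarrow> 0"
    unfolding c_def using tendsto_real_sqrt by force
  then have bound_lim: "(\<lambda>N. (4 * C + 2) * c N / \<epsilon>) \<longlonglongrightarrow> 0"
    using \<epsilon> by (auto intro!: tendsto_eq_intros)
  let ?p = "\<lambda>N. measure (P N) {\<omega> \<in> space (P N).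
    \<bar>tv_dist (gibbs_marginal \<beta> N (M N) (k N) (\<lambda>i. \<xi> N i \<omega>)) (rademacher_power (k N)) - 0\<bar> > \<epsilon>}"
  \<comment> \<open>For large \<open>N\<close> the blocks are nonempty and \<open>c N < 1\<close>,
    as the exponential moment bound requires.\<close>
  have "\<forall>\<^sub>F N in sequentially. ?p N \<le> (4 * C + 2) * c N / \<epsilon>"
    using eventually_ge_at_top[of 1] filterlim_at_top[THEN iffD1, OF k_infinity, rule_format, of 1]
      order_tendstoD(2)[OF c_lim zero_less_one]
  proof eventually_elim
    case (elim N)
    interpret hopfield_disorder "P N" N "M N" "\<xi> N" using elim(1) by (rule disorder)
    define T where "T = avg (patterns N (M N))
      (\<lambda>x. tv_dist (gibbs_marginal \<beta> N (M N) (k N) x) (rademacher_power (k N)))"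
    define n where "n = N div k N"
    have N: "0 < real N" and kN: "k N \<le> N" using elim(1) k_le_N by auto
    have nk: "n * k N \<le> N" by (simp add: n_def)
    have n: "1 \<le> n" unfolding n_def using elim(2) kN by (simp add: Suc_le_eq div_greater_zero_iff)
    \<comment> \<open>The complete blocks cover at least half of the sites, so \<open>n\<close> is
      comparable to \<open>N / k N\<close>.\<close>
    have "N \<le> n * k N + k N"
      using mod_less_divisor[of "k N" N] elim(2) div_mult_mod_eq[of N "k N"]
      unfolding n_def by linarith
    also have "\<dots> \<le> 2 * (n * k N)" using n by simp
    finally have "real N \<le> real (2 * (n * k N))" by (rule of_nat_mono)
    then have nk2: "real N \<le> 2 * real n * real (k N)" by simp
    have r0: "0 \<le> r N" by (simp add: r_def)
    then have "0 < r N + 1 / real N" using N by (intro add_nonneg_pos) auto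
    then have c: "0 < c N" "r N \<le> (c N)\<^sup>2" by (simp_all add: c_def)
    have "real (M N) * real (k N) = r N * real N" using N by (simp add: r_def)
    also have "\<dots> \<le> r N * (2 * real n * real (k N))" using nk2 r0 by (rule mult_left_mono)
    finally have "real (M N) * real (k N) \<le> (2 * r N * real n) * real (k N)" by (simp only: mult_ac)
    then have "real (M N) \<le> 2 * r N * real n" using elim(2) by simp
    also have "\<dots> \<le> 2 * (c N)\<^sup>2 * real n" using c(2) by (intro mult_right_mono) auto
    finally have "C * real (M N) \<le> C * (2 * (c N)\<^sup>2 * real n)" using C by (rule mult_left_mono)
    moreover have "c N / 2 * (real n * T) \<le> C * real (M N) + real n * (c N)\<^sup>2"
      using avg_tv_dist_le[OF beta(1) \<beta>' _ kN nk, of "c N" "M N"] elim c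
      unfolding T_def C_def by (simp only: less_imp_le mult_ac)
    \<comment> \<open>Both terms on the right are multiples of
      \<open>real n * (c N)\<^sup>2\<close>, with factors \<open>2 * C\<close> and 1; taking out
      \<open>real n * c N / 2\<close> leaves \<open>(4 * C + 2) * c N\<close>.\<close>
    ultimately have "(real n * c N / 2) * T \<le> (real n * c N / 2) * ((4 * C + 2) * c N)"
      by (simp add: algebra_simps power2_eq_square)
    then have "T \<le> (4 * C + 2) * c N"
      using n c(1) by (subst (asm) mult_le_cancel_left_pos) auto
    then show ?case
      using prob_tv_dist_le[of \<epsilon> \<beta> "k N"] elim(1) \<epsilon> unfolding T_def
      by (meson divide_right_mono less_imp_le order_trans less_le_trans zero_less_one)
  qed
  then show "?p \<longlonglongrightarrow> 0"
    by (intro tendsto_sandwich[OF _ _ tendsto_const bound_lim]) auto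
qed

end
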